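(* Let $A$ be a monoid (with absorbing element $0$), and let $A^\times$ be its group of invertible elements. Then: (1) An $n\times n$ matrix $M$ lies in $E(A)$ if and only if $M=D(a_1,\dots,a_n)\sigma$, where $\sigma$ is (the permutation matrix of) an even permutation, $a_1,\dots,a_n\in A^\times$, and $a_1a_2\cdots a_n\in[A^\times,A^\times]$. (2) $E(A)$ is a perfect group, i.e. $E(A)=[E(A),E(A)]$.
   Context: A monoid means a not necessarily commutative monoid with unit $1$ and an absorbing element $0$ ($0a=a0=0$ for all $a$). $\mathbb{Z}[A]$ denotes the quotient of the monoid ring $\mathbb{Z}A$ by the ideal $\mathbb{Z}\cdot 0$, where $0$ is the absorbing element of $A$. $M_n(A)$ is the set of $n\times n$ matrices $(m_{ij})$ over $\mathbb{Z}[A]$ all of whose entries lie in $A$ and for which there is a map $f:\{1,\dots,n\}\to\{1,\dots,n\}$ with $m_{ij}=0$ whenever $f(i)\neq j$; it is a monoid under matrix multiplication. $GL_n(A)$ is the group of invertible elements of $M_n(A)$; each of its elements can be written $D(a_1,\dots,a_n)\sigma$ with $\sigma$ a permutation matrix and $D(a_1,\dots,a_n)$ the diagonal matrix with diagonal entries $a_1,\dots,a_n\in A^\times$. Via the natural inclusions $GL_n(A)\to GL_{n+1}(A)$ (adding a diagonal entry $1$), put $GL(A)=\bigcup_{n\ge1}GL_n(A)$, and $E(A)=[GL(A),GL(A)]$, the commutator subgroup. An $n\times n$ matrix $M\in GL_n(A)$ is regarded as an element of $GL(A)$. *)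

theory Defs
  imports
    "HOL-Library.Poly_Mapping"
    "HOL-Combinatorics.Permutations"
    "HOL-Algebra.QuotRing"
    "HOL-Algebra.Generated_Groups"
begin

locale monoid_with_zero = monoid A for A (structure) +
  fixes z
  assumes zero_closed: "z \<in> carrier A"
    and zero_mult_left: "a \<in> carrier A \<Longrightarrow> z \<otimes> a = z"
    and zero_mult_right: "a \<in> carrier A \<Longrightarrow> a \<otimes> z = z"

section \<open>The ring \<open>\<int>[A]\<close>\<close>

text \<open>
  An element of the monoid ring \<open>\<int>A\<close> is a finitely supported integer-valued function on
  \<^term>\<open>carrier A\<close>. Since \<^const>\<open>frag_extend\<close> is extension by \<open>\<int>\<close>-linearity from the basis,
  the product is the \<open>\<int>\<close>-bilinear extension of the product of \<open>A\<close>.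
\<close>

definition monoid_ring :: "('a, 'm) monoid_scheme \<Rightarrow> ('a \<Rightarrow>\<^sub>0 int) ring" where
  "monoid_ring A =
    \<lparr>carrier = {c. Poly_Mapping.keys c \<subseteq> carrier A},
     mult = (\<lambda>c d. frag_extend (\<lambda>a. frag_extend (\<lambda>b. frag_of (a \<otimes>\<^bsub>A\<^esub> b)) d) c),
     one = frag_of \<one>\<^bsub>A\<^esub>,
     zero = 0,
     add = (+)\<rparr>"

definition zero_ideal :: "'a \<Rightarrow> ('a \<Rightarrow>\<^sub>0 int) set" where
  "zero_ideal z = range (\<lambda>k. frag_cmul k (frag_of z))"

definition reduced_ring :: "('a, 'm) monoid_scheme \<Rightarrow> 'a \<Rightarrow> ('a \<Rightarrow>\<^sub>0 int) set ring" where
  "reduced_ring A z = monoid_ring A Quot zero_ideal z"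

text \<open>The canonical map \<open>A \<rightarrow> \<int>[A]\<close>; it is injective and sends the absorbing element to \<open>0\<close>.\<close>

definition emb :: "('a, 'm) monoid_scheme \<Rightarrow> 'a \<Rightarrow> 'a \<Rightarrow> ('a \<Rightarrow>\<^sub>0 int) set" where
  "emb A z a = zero_ideal z +>\<^bsub>monoid_ring A\<^esub> frag_of a"

section \<open>Matrices\<close>

text \<open>
  Rows and columns of an \<open>n \<times> n\<close> matrix are indexed by \<open>0, \<dots>, n - 1\<close>, and a matrix is
  \<^const>\<open>undefined\<close> outside this range, so that equality of matrices is equality of functions.
\<close>

definition mats :: "('r, 'm) ring_scheme \<Rightarrow> nat \<Rightarrow> (nat \<Rightarrow> nat \<Rightarrow> 'r) monoid" where
  "mats R n =
    \<lparr>carrier = {..<n} \<rightarrow>\<^sub>E ({..<n} \<rightarrow>\<^sub>E carrier R),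
     mult = (\<lambda>M N. \<lambda>i\<in>{..<n}. \<lambda>j\<in>{..<n}. \<Oplus>\<^bsub>R\<^esub>k\<in>{..<n}. M i k \<otimes>\<^bsub>R\<^esub> N k j),
     one = (\<lambda>i\<in>{..<n}. \<lambda>j\<in>{..<n}. if i = j then \<one>\<^bsub>R\<^esub> else \<zero>\<^bsub>R\<^esub>)\<rparr>"

definition Mn :: "('a, 'm) monoid_scheme \<Rightarrow> 'a \<Rightarrow> nat \<Rightarrow> (nat \<Rightarrow> nat \<Rightarrow> ('a \<Rightarrow>\<^sub>0 int) set) monoid" where
  "Mn A z n = (mats (reduced_ring A z) n)
    \<lparr>carrier := {M \<in> {..<n} \<rightarrow>\<^sub>E ({..<n} \<rightarrow>\<^sub>E emb A z ` carrier A).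
       \<exists>f \<in> {..<n} \<rightarrow> {..<n}. \<forall>i<n. \<forall>j<n. f i \<noteq> j \<longrightarrow> M i j = \<zero>\<^bsub>reduced_ring A z\<^esub>}\<rparr>"

definition GLn :: "('a, 'm) monoid_scheme \<Rightarrow> 'a \<Rightarrow> nat \<Rightarrow> (nat \<Rightarrow> nat \<Rightarrow> ('a \<Rightarrow>\<^sub>0 int) set) monoid" where
  "GLn A z n = units_of (Mn A z n)"

definition diag_mat :: "('a, 'm) monoid_scheme \<Rightarrow> 'a \<Rightarrow> nat \<Rightarrow> (nat \<Rightarrow> 'a) \<Rightarrow> nat \<Rightarrow> nat \<Rightarrow> ('a \<Rightarrow>\<^sub>0 int) set" where
  "diag_mat A z n a = (\<lambda>i\<in>{..<n}. \<lambda>j\<in>{..<n}. if i = j then emb A z (a i) else \<zero>\<^bsub>reduced_ring A z\<^esub>)"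

text \<open>The permutation matrix of \<open>\<sigma>\<close> sends the \<open>j\<close>-th basis column to the \<open>\<sigma> j\<close>-th one.\<close>

definition perm_mat :: "('r, 'm) ring_scheme \<Rightarrow> nat \<Rightarrow> (nat \<Rightarrow> nat) \<Rightarrow> nat \<Rightarrow> nat \<Rightarrow> 'r" where
  "perm_mat R n \<sigma> = (\<lambda>i\<in>{..<n}. \<lambda>j\<in>{..<n}. if i = \<sigma> j then \<one>\<^bsub>R\<^esub> else \<zero>\<^bsub>R\<^esub>)"

section \<open>The stable group\<close>

text \<open>
  The union of the groups \<^term>\<open>GLn A z n\<close> along \<open>M \<mapsto> diag(M, 1)\<close> is realised inside the
  matrices indexed by all natural numbers: \<open>M\<close> is identified with \<open>diag(M, 1, 1, \<dots>)\<close>.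
  Each row of such a matrix has finite support, so restricting the sum in the product to the
  support makes it a finite sum.
\<close>

definition stab :: "('r, 'm) ring_scheme \<Rightarrow> nat \<Rightarrow> (nat \<Rightarrow> nat \<Rightarrow> 'r) \<Rightarrow> nat \<Rightarrow> nat \<Rightarrow> 'r" where
  "stab R n M = (\<lambda>i j. if i < n \<and> j < n then M i j else if i = j then \<one>\<^bsub>R\<^esub> else \<zero>\<^bsub>R\<^esub>)"

definition GL :: "('a, 'm) monoid_scheme \<Rightarrow> 'a \<Rightarrow> (nat \<Rightarrow> nat \<Rightarrow> ('a \<Rightarrow>\<^sub>0 int) set) monoid" where
  "GL A z = (let R = reduced_ring A z in
    \<lparr>carrier = (\<Union>n\<in>{1..}. stab R n ` carrier (GLn A z n)),
     mult = (\<lambda>M N i j. \<Oplus>\<^bsub>R\<^esub>k\<in>{k. M i k \<noteq> \<zero>\<^bsub>R\<^esub>}. M i k \<otimes>\<^bsub>R\<^esub> N k j),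
     one = (\<lambda>i j. if i = j then \<one>\<^bsub>R\<^esub> else \<zero>\<^bsub>R\<^esub>)\<rparr>)"

definition E_grp :: "('a, 'm) monoid_scheme \<Rightarrow> 'a \<Rightarrow> (nat \<Rightarrow> nat \<Rightarrow> ('a \<Rightarrow>\<^sub>0 int) set) set" where
  "E_grp A z = derived (GL A z) (carrier (GL A z))"

section \<open>\<open>\<int>[A]\<close> is a ring\<close>

lemma (in monoid) ring_monoid_ring: "ring (monoid_ring G)"
proof -
  let ?R = "monoid_ring G"
  have keys_mult: "Poly_Mapping.keys (c \<otimes>\<^bsub>?R\<^esub> d) \<subseteq> carrier G"
    if "Poly_Mapping.keys c \<subseteq> carrier G" "Poly_Mapping.keys d \<subseteq> carrier G" for c d
    unfolding monoid_ring_def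
    using keys_frag_extend[of _ c] keys_frag_extend[of _ d] that
    by simp (use m_closed in \<open>fastforce simp: keys_frag_of dest!: subsetD[OF keys_frag_extend]\<close>)
  have add_l: "(c + c') \<otimes>\<^bsub>?R\<^esub> d = (c \<otimes>\<^bsub>?R\<^esub> d) + (c' \<otimes>\<^bsub>?R\<^esub> d)"
   and diff_l: "(c - c') \<otimes>\<^bsub>?R\<^esub> d = (c \<otimes>\<^bsub>?R\<^esub> d) - (c' \<otimes>\<^bsub>?R\<^esub> d)" for c c' d
    by (simp_all add: monoid_ring_def frag_extend_add frag_extend_diff)
  have ext_add: "frag_extend (\<lambda>a. f a + g a) c = frag_extend f c + frag_extend g c"
   and ext_diff: "frag_extend (\<lambda>a. f a - g a) c = frag_extend f c - frag_extend g c"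
    for f g :: "'a \<Rightarrow> 'a \<Rightarrow>\<^sub>0 int" and c
    by (simp_all add: frag_extend_def frag_cmul_distrib2 sum.distrib
        diff_conv_add_uminus sum_negf del: add_uminus_conv_diff minus_frag_cmul)
      (metis (no_types, lifting) frag_cmul_cmul frag_cmul_minus_one mult.commute sum.cong sum_negf)+
  have add_r: "d \<otimes>\<^bsub>?R\<^esub> (c + c') = (d \<otimes>\<^bsub>?R\<^esub> c) + (d \<otimes>\<^bsub>?R\<^esub> c')"
   and diff_r: "d \<otimes>\<^bsub>?R\<^esub> (c - c') = (d \<otimes>\<^bsub>?R\<^esub> c) - (d \<otimes>\<^bsub>?R\<^esub> c')" for c c' d
    by (simp_all add: monoid_ring_def frag_extend_add frag_extend_diff ext_add ext_diff)
  have zero_l: "0 \<otimes>\<^bsub>?R\<^esub> d = 0" and zero_r: "d \<otimes>\<^bsub>?R\<^esub> 0 = 0" for d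
    using diff_l[of 0 0 d] diff_r[of d 0 0] by simp_all
  have basis: "frag_of a \<otimes>\<^bsub>?R\<^esub> frag_of b = frag_of (a \<otimes> b)" for a b
    by (simp add: monoid_ring_def)
  have one_l: "frag_of \<one> \<otimes>\<^bsub>?R\<^esub> c = c" and one_r: "c \<otimes>\<^bsub>?R\<^esub> frag_of \<one> = c"
    if "Poly_Mapping.keys c \<subseteq> carrier G" for c
    using that
    by (induction c rule: frag_induction) (simp_all add: basis diff_l diff_r zero_l zero_r)
  have assoc: "(c \<otimes>\<^bsub>?R\<^esub> d) \<otimes>\<^bsub>?R\<^esub> e = c \<otimes>\<^bsub>?R\<^esub> (d \<otimes>\<^bsub>?R\<^esub> e)"
    if c: "Poly_Mapping.keys c \<subseteq> carrier G" and d: "Poly_Mapping.keys d \<subseteq> carrier G"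
      and e: "Poly_Mapping.keys e \<subseteq> carrier G" for c d e
    using c
  proof (induction c rule: frag_induction)
    case (one a)
    from d show ?case
    proof (induction d rule: frag_induction)
      case (one b)
      from e show ?case
        by (induction e rule: frag_induction)
          (use \<open>a \<in> carrier G\<close> one in \<open>simp_all add: basis diff_r zero_r m_assoc\<close>)
    qed (simp_all add: diff_l diff_r zero_l zero_r)
  qed (simp_all add: diff_l zero_l)
  have sel: "carrier ?R = {c. Poly_Mapping.keys c \<subseteq> carrier G}" "\<one>\<^bsub>?R\<^esub> = frag_of \<one>"
    "\<zero>\<^bsub>?R\<^esub> = 0" "\<And>c d. c \<oplus>\<^bsub>?R\<^esub> d = c + d"
    by (simp_all add: monoid_ring_def)
  show ?thesis
  proof (rule ringI)
    show "abelian_group ?R"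
    proof (rule abelian_groupI)
      show "\<exists>d\<in>carrier ?R. d \<oplus>\<^bsub>?R\<^esub> c = \<zero>\<^bsub>?R\<^esub>" if "c \<in> carrier ?R" for c
        by (rule bexI[of _ "- c"]) (use that in \<open>simp_all add: sel\<close>)
    qed (use keys_add in \<open>fastforce simp: sel add.assoc add.commute\<close>)+
    show "monoid ?R"
      by (rule monoidI) (simp_all add: sel keys_mult one_l one_r assoc keys_frag_of)
  qed (simp_all add: sel add_l add_r)
qed

lemma (in monoid_with_zero) ideal_zero_ideal: "ideal (zero_ideal z) (monoid_ring A)"
proof (rule idealI)
  let ?R = "monoid_ring A"
  interpret R: ring ?R by (rule ring_monoid_ring)
  have mem: "frag_cmul k (frag_of z) \<in> zero_ideal z" for k
    by (simp add: zero_ideal_def)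
  show "subgroup (zero_ideal z) (add_monoid ?R)"
  proof (rule R.add.subgroupI)
    show "zero_ideal z \<subseteq> carrier ?R"
      using zero_closed keys_cmul
      by (fastforce simp: zero_ideal_def monoid_ring_def keys_frag_of)
    then show "\<ominus>\<^bsub>?R\<^esub> c \<in> zero_ideal z" if "c \<in> zero_ideal z" for c
    proof -
      obtain k where c: "c = frag_cmul k (frag_of z)"
        using \<open>c \<in> zero_ideal z\<close> by (auto simp: zero_ideal_def)
      have "frag_cmul (- k) (frag_of z) \<oplus>\<^bsub>?R\<^esub> c = \<zero>\<^bsub>?R\<^esub>"
        by (simp add: c monoid_ring_def flip: frag_cmul_distrib)
      then have "\<ominus>\<^bsub>?R\<^esub> c = frag_cmul (- k) (frag_of z)"
        using \<open>zero_ideal z \<subseteq> carrier ?R\<close> mem[of "- k"] that R.minus_equality by blast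
      then show ?thesis
        using mem by metis
    qed
    show "c \<oplus>\<^bsub>?R\<^esub> d \<in> zero_ideal z" if "c \<in> zero_ideal z" "d \<in> zero_ideal z" for c d
      using that mem by (auto simp: zero_ideal_def monoid_ring_def simp flip: frag_cmul_distrib)
  qed (use mem in auto)
  have ext: "frag_extend (\<lambda>a. frag_cmul k (frag_of z)) x \<in> zero_ideal z" for k and x :: "'a \<Rightarrow>\<^sub>0 int"
  proof (rule frag_induction[where c = x and S = UNIV])
    show "frag_extend (\<lambda>a. frag_cmul k (frag_of z)) 0 \<in> zero_ideal z"
      using mem[of 0] by simp
  next
    fix c d :: "'a \<Rightarrow>\<^sub>0 int"
    assume "frag_extend (\<lambda>a. frag_cmul k (frag_of z)) c \<in> zero_ideal z"
      and "frag_extend (\<lambda>a. frag_cmul k (frag_of z)) d \<in> zero_ideal z"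
    then show "frag_extend (\<lambda>a. frag_cmul k (frag_of z)) (c - d) \<in> zero_ideal z"
      using mem by (auto simp: zero_ideal_def frag_extend_diff simp flip: frag_cmul_diff_distrib)
  qed (use mem in auto)
  show "x \<otimes>\<^bsub>?R\<^esub> c \<in> zero_ideal z" if c: "c \<in> zero_ideal z" and x: "x \<in> carrier ?R" for c x
  proof -
    obtain k where c: "c = frag_cmul k (frag_of z)"
      using c by (auto simp: zero_ideal_def)
    have "x \<otimes>\<^bsub>?R\<^esub> c = frag_extend (\<lambda>a. frag_cmul k (frag_of z)) x"
      unfolding c monoid_ring_def using x
      by (auto simp: frag_extend_cmul zero_mult_right monoid_ring_def intro!: frag_extend_eq)
    then show ?thesis
      using ext by simp
  qed
  show "c \<otimes>\<^bsub>?R\<^esub> x \<in> zero_ideal z" if c: "c \<in> zero_ideal z" and x: "x \<in> carrier ?R" for c x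
  proof -
    obtain k where c: "c = frag_cmul k (frag_of z)"
      using c by (auto simp: zero_ideal_def)
    have "frag_extend (\<lambda>b. frag_of (z \<otimes> b)) x = frag_extend (\<lambda>a. frag_cmul 1 (frag_of z)) x"
      using x by (auto simp: zero_mult_left monoid_ring_def intro!: frag_extend_eq)
    then obtain l where "frag_extend (\<lambda>b. frag_of (z \<otimes> b)) x = frag_cmul l (frag_of z)"
      using ext[of 1 x] by (auto simp: zero_ideal_def)
    then show ?thesis
      using mem by (simp add: c monoid_ring_def frag_extend_cmul)
  qed
qed (rule ring_monoid_ring)

lemma (in monoid_with_zero) ring_reduced_ring: "ring (reduced_ring A z)"
  unfolding reduced_ring_def by (rule ideal.quotient_is_ring[OF ideal_zero_ideal])

end

theory Submission
  imports Defs
begin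

text \<open>
  A monomial matrix is a diagonal of units times a permutation, so \<open>GL(A)\<close> is the image of the
  restricted wreath product \<open>W\<close> of \<open>A\<^sup>\<times>\<close> with the finitary permutations of \<open>\<nat>\<close>, and derived
  subgroups commute with surjective homomorphisms. The sign and the total product modulo
  \<open>[A\<^sup>\<times>, A\<^sup>\<times>]\<close> are homomorphisms from \<open>W\<close> to commutative groups, which bounds \<open>[W, W]\<close> from above.
  Conversely, every element with trivial invariants is a product of commutators of even
  permutations and diagonals \<open>diag(\<dots>, u, \<dots>, u\<^sup>-\<^sup>1, \<dots>)\<close>: infinitely many spare indices
  allow every auxiliary permutation to be made even and every auxiliary diagonal to have
  product 1. Since these elements themselves lie in \<open>[W, W]\<close>, the same argument run inside
  \<open>[W, W]\<close> gives perfectness.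
\<close>

section \<open>The restricted wreath product and its derived subgroup\<close>

text \<open>The pair \<open>(d, \<sigma>)\<close> encodes D(d)\<sigma>, with \<open>d i\<close> the
  entry in row \<open>i\<close>. Total functions that are trivial from \<open>n\<close> on turn the
  embedding of GL_n into GL_(n+1) into a plain inclusion of sets.\<close>

definition wreath_level :: "('a, 'm) monoid_scheme \<Rightarrow> nat \<Rightarrow> ((nat \<Rightarrow> 'a) \<times> (nat \<Rightarrow> nat)) set" where
  "wreath_level G n =
    {(d, \<sigma>). (\<forall>i. d i \<in> carrier G) \<and> (\<forall>i\<ge>n. d i = \<one>\<^bsub>G\<^esub>) \<and> \<sigma> permutes {..<n}}"

text \<open>The product comes from D(d)\<sigma> D(e)\<tau> = D(d) (\<sigma> D(e) \<sigma>^-1)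
  \<sigma>\<tau>: conjugation by \<sigma> moves the entry at \<open>inv_into UNIV \<sigma> i\<close>
  to position \<open>i\<close>.\<close>

definition wreath :: "('a, 'm) monoid_scheme \<Rightarrow> ((nat \<Rightarrow> 'a) \<times> (nat \<Rightarrow> nat)) monoid" where
  "wreath G =
    \<lparr>carrier = (\<Union>n. wreath_level G n),
     mult = (\<lambda>(d, \<sigma>) (e, \<tau>). (\<lambda>i. d i \<otimes>\<^bsub>G\<^esub> e (inv_into UNIV \<sigma> i), \<sigma> \<circ> \<tau>)),
     one = (\<lambda>_. \<one>\<^bsub>G\<^esub>, id)\<rparr>"

lemma wreath_mult [simp]:
  "(d, \<sigma>) \<otimes>\<^bsub>wreath G\<^esub> (e, \<tau>) = (\<lambda>i. d i \<otimes>\<^bsub>G\<^esub> e (inv_into UNIV \<sigma> i), \<sigma> \<circ> \<tau>)"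
  by (simp add: wreath_def)

lemma wreath_one: "\<one>\<^bsub>wreath G\<^esub> = (\<lambda>_. \<one>\<^bsub>G\<^esub>, id)"
  by (simp add: wreath_def)

lemma wreath_level_mono: "m \<le> n \<Longrightarrow> wreath_level G m \<subseteq> wreath_level G n"
  by (auto simp: wreath_level_def intro: permutes_subset)

lemma wreath_level_carrier: "x \<in> wreath_level G n \<Longrightarrow> x \<in> carrier (wreath G)"
  by (auto simp: wreath_def)

lemma wreath_carrierE:
  assumes "x \<in> carrier (wreath G)"
  obtains d \<sigma> n where "x = (d, \<sigma>)" "(d, \<sigma>) \<in> wreath_level G n"
  using assms by (cases x) (auto simp: wreath_def)

lemma wreath_carrier_common_level:
  assumes "x \<in> carrier (wreath G)" "y \<in> carrier (wreath G)"
  obtains n where "x \<in> wreath_level G n" "y \<in> wreath_level G n"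
proof -
  obtain m n where "x \<in> wreath_level G m" "y \<in> wreath_level G n"
    using assms by (auto simp: wreath_def)
  then show ?thesis
    using that[of "max m n"] wreath_level_mono[of m "max m n" G] wreath_level_mono[of n "max m n" G] by auto
qed

text \<open>The last hypothesis says that \<open>c\<close> is the commutator of \<open>x\<close> and
  \<open>y\<close> in a form free of inverses, so that applications in \<open>W\<close> only have to
  compare products.\<close>

lemma (in group) commutator_in_derived:
  assumes "H \<subseteq> carrier G" "x \<in> H" "y \<in> H" "c \<in> carrier G" "x \<otimes> y = c \<otimes> (y \<otimes> x)"
  shows "c \<in> derived G H"
proof -
  have "x \<in> carrier G" "y \<in> carrier G"
    using assms by auto
  then have "c = x \<otimes> y \<otimes> inv x \<otimes> inv y"
    using assms(4,5) by (simp add: m_assoc inv_mult_group[symmetric])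
  then show ?thesis
    unfolding derived_def using assms(2,3) by (intro generate.incl) blast
qed

text \<open>The image of the derived subgroup is the derived subgroup of the image, which is trivial
  inside a commutative group.\<close>

lemma (in group_hom) hom_derived_eq_one:
  assumes "comm_group H" "x \<in> derived G (carrier G)"
  shows "h x = \<one>\<^bsub>H\<^esub>"
proof -
  interpret H: comm_group H by fact
  have "derived H (h ` carrier G) = {\<one>\<^bsub>H\<^esub>}"
    by (rule H.derived_eq_singleton) auto
  then show ?thesis
    using derived_img[of "carrier G"] assms(2) by auto
qed

section \<open>Ordered products of possibly noncommuting factors\<close>

abbreviation list_prod :: "('a, 'm) monoid_scheme \<Rightarrow> (nat \<Rightarrow> 'a) \<Rightarrow> nat \<Rightarrow> 'a" where
  "list_prod G d n \<equiv> foldr (mult G) (map d [0..<n]) \<one>\<^bsub>G\<^esub>"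

lemma (in monoid) foldr_mult_eq:
  assumes "set xs \<subseteq> carrier G" "y \<in> carrier G"
  shows "foldr (\<otimes>) xs \<one> \<in> carrier G \<and> foldr (\<otimes>) xs y = foldr (\<otimes>) xs \<one> \<otimes> y"
  using assms by (induction xs) (auto simp: m_assoc)

lemma (in monoid) list_prod_closed [simp, intro]:
  "(\<And>i. d i \<in> carrier G) \<Longrightarrow> list_prod G d n \<in> carrier G"
  using foldr_mult_eq[of "map d [0..<n]" \<one>] by auto

text \<open>\<open>foldr\<close> consumes the list from the front while \<open>[0..<Suc n]\<close>
  grows at the back; \<open>foldr_mult_eq\<close> pulls the last factor out to the right.\<close>

lemma (in monoid) list_prod_Suc:
  "(\<And>i. d i \<in> carrier G) \<Longrightarrow> list_prod G d (Suc n) = list_prod G d n \<otimes> d n"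
  using foldr_mult_eq[of "map d [0..<n]" "d n"] by (auto simp: subset_iff)

context group
begin

abbreviation W where "W \<equiv> wreath G"

lemma wreath_level_mult:
  assumes "x \<in> wreath_level G n" "y \<in> wreath_level G n"
  shows "x \<otimes>\<^bsub>W\<^esub> y \<in> wreath_level G n"
  using assms
  by (cases x; cases y)
    (auto simp: wreath_level_def permutes_compose permutes_not_in[OF permutes_inv])

lemma wreath_level_inverse:
  assumes "x \<in> wreath_level G n"
  shows "\<exists>y\<in>wreath_level G n. y \<otimes>\<^bsub>W\<^esub> x = \<one>\<^bsub>W\<^esub>"
proof -
  obtain d \<sigma> where x: "x = (d, \<sigma>)"
    by (cases x)
  then have p: "\<sigma> permutes {..<n}"
    using assms by (simp add: wreath_level_def)
  \<comment> \<open>This is \<sigma>^-1 D(d)^-1 with the diagonal brought to the front. It stays on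
    level \<open>n\<close>, which later yields inverses inside \<open>Mn A z n\<close>.\<close>
  let ?y = "(\<lambda>i. inv (d (\<sigma> i)), inv_into UNIV \<sigma>)"
  have "?y \<in> wreath_level G n"
    using assms p by (auto simp: x wreath_level_def permutes_inv permutes_not_in)
  moreover have "?y \<otimes>\<^bsub>W\<^esub> x = \<one>\<^bsub>W\<^esub>"
    using assms p by (auto simp: x wreath_one wreath_level_def permutes_inv_inv permutes_inv_o)
  ultimately show ?thesis
    by blast
qed

lemma group_wreath: "group W"
proof (rule groupI)
  show "x \<otimes>\<^bsub>W\<^esub> y \<in> carrier W" if "x \<in> carrier W" "y \<in> carrier W" for x y
    using that wreath_level_mult wreath_carrier_common_level wreath_level_carrier by metis
  show one: "\<one>\<^bsub>W\<^esub> \<in> carrier W"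
    by (auto simp: wreath_def wreath_level_def permutes_id)
  show "x \<otimes>\<^bsub>W\<^esub> y \<otimes>\<^bsub>W\<^esub> u = x \<otimes>\<^bsub>W\<^esub> (y \<otimes>\<^bsub>W\<^esub> u)"
    if "x \<in> carrier W" "y \<in> carrier W" "u \<in> carrier W" for x y u
    using that
    by (elim wreath_carrierE)
      (auto simp: wreath_level_def m_assoc o_assoc o_inv_distrib permutes_bij)
  show "\<one>\<^bsub>W\<^esub> \<otimes>\<^bsub>W\<^esub> x = x" if "x \<in> carrier W" for x
    using that by (elim wreath_carrierE) (auto simp: wreath_one wreath_level_def)
  show "\<exists>y\<in>carrier W. y \<otimes>\<^bsub>W\<^esub> x = \<one>\<^bsub>W\<^esub>" if "x \<in> carrier W" for x
    using that by (elim wreath_carrierE) (blast dest: wreath_level_inverse intro: wreath_level_carrier)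
qed

section \<open>Generators, and the lower bound for the derived subgroup\<close>

definition wperm :: "(nat \<Rightarrow> nat) \<Rightarrow> (nat \<Rightarrow> 'a) \<times> (nat \<Rightarrow> nat)" where
  "wperm \<sigma> = (\<lambda>_. \<one>, \<sigma>)"

definition wdiag :: "nat \<Rightarrow> 'a \<Rightarrow> (nat \<Rightarrow> 'a) \<times> (nat \<Rightarrow> nat)" where
  "wdiag i u = ((\<lambda>_. \<one>)(i := u), id)"

definition wdiag2 :: "nat \<Rightarrow> nat \<Rightarrow> 'a \<Rightarrow> (nat \<Rightarrow> 'a) \<times> (nat \<Rightarrow> nat)" where
  "wdiag2 i j u = ((\<lambda>_. \<one>)(i := u, j := inv u), id)"

lemma permutation_permutes_lessThan:
  assumes "permutation \<sigma>"
  obtains n :: nat where "\<sigma> permutes {..<n}"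
proof -
  obtain S where "finite S" "\<sigma> permutes S"
    using assms by (auto simp: permutation_permutes)
  moreover obtain n where "S \<subseteq> {..<n}"
    using \<open>finite S\<close> by (auto simp: finite_nat_set_iff_bounded)
  ultimately show ?thesis
    using that permutes_subset by blast
qed

lemma wperm_closed [simp, intro]: "permutation \<sigma> \<Longrightarrow> wperm \<sigma> \<in> carrier W"
  by (erule permutation_permutes_lessThan)
    (auto simp: wperm_def wreath_level_def intro!: wreath_level_carrier)

lemma wdiag_closed [simp, intro]: "u \<in> carrier G \<Longrightarrow> wdiag i u \<in> carrier W"
  by (rule wreath_level_carrier[of _ _ "Suc i"]) (auto simp: wdiag_def wreath_level_def permutes_id)

lemma wdiag2_closed [simp, intro]: "u \<in> carrier G \<Longrightarrow> wdiag2 i j u \<in> carrier W"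
  by (rule wreath_level_carrier[of _ _ "Suc (max i j)"])
    (auto simp: wdiag2_def wreath_level_def permutes_id)

lemma wperm_comp: "wperm (\<sigma> \<circ> \<tau>) = wperm \<sigma> \<otimes>\<^bsub>W\<^esub> wperm \<tau>"
  by (simp add: wperm_def)

text \<open>\<open>H\<close> is variable because the lemma serves twice:
  \<open>H = carrier W\<close> bounds \<open>[W, W]\<close> from below, and
  \<open>H = [W, W]\<close> gives perfectness. The first two conclusions in the first use supply the
  hypotheses for the second.\<close>

lemma derived_wreath_contains:
  assumes H: "H \<subseteq> carrier W"
    and perm: "\<And>\<sigma>. permutation \<sigma> \<Longrightarrow> evenperm \<sigma> \<Longrightarrow> wperm \<sigma> \<in> H"
    and diag2: "\<And>i j u. i \<noteq> j \<Longrightarrow> u \<in> carrier G \<Longrightarrow> wdiag2 i j u \<in> H"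
  shows derived_wreath_even: "permutation \<sigma> \<Longrightarrow> evenperm \<sigma> \<Longrightarrow> wperm \<sigma> \<in> derived W H"
    and derived_wreath_diag2: "i \<noteq> j \<Longrightarrow> u \<in> carrier G \<Longrightarrow> wdiag2 i j u \<in> derived W H"
    and derived_wreath_in: "(d, \<sigma>) \<in> wreath_level G n \<Longrightarrow> evenperm \<sigma> \<Longrightarrow>
          list_prod G d n \<in> derived G (carrier G) \<Longrightarrow> (d, \<sigma>) \<in> derived W H"
proof -
  interpret W: group W by (rule group_wreath)
  have sub: "subgroup (derived W H) W"
    using H by (rule W.derived_is_subgroup)
  note D_closed = subgroup.m_closed[OF sub]
  have perm_swaps: "permutation (transpose a b \<circ> transpose c d)" for a b c d :: nat
    by (simp add: permutation_compose permutation_swap_id)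
  have even_swaps: "evenperm (transpose a b \<circ> transpose c d)" if "a \<noteq> b" "c \<noteq> d" for a b c d :: nat
    using that by (simp add: evenperm_comp permutation_swap_id evenperm_swap)
  \<comment> \<open>\<open>?s\<close> is a 3-cycle on \<open>x\<close>, \<open>y\<close>,
    \<open>b\<close>. Conjugating \<open>?t\<close> = (a x)(b y) by it gives (a y)(x b), and the
    product of these two is the third double transposition (a b)(x y) on the four points.\<close>
  have disj: "wperm (transpose a b \<circ> transpose x y) \<in> derived W H" if "distinct [a, b, x, y]" for a b x y
  proof (rule W.commutator_in_derived[OF H])
    let ?s = "transpose x b \<circ> transpose x y" and ?t = "transpose a x \<circ> transpose b y"
    show "wperm ?s \<in> H" "wperm ?t \<in> H"
      using that by (auto intro!: perm perm_swaps even_swaps)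
    have "?s \<circ> ?t = transpose a b \<circ> transpose x y \<circ> (?t \<circ> ?s)"
    proof
      fix z show "(?s \<circ> ?t) z = (transpose a b \<circ> transpose x y \<circ> (?t \<circ> ?s)) z"
        using that
        by (cases "z = a"; cases "z = b"; cases "z = x"; cases "z = y"; simp add: transpose_def)
    qed
    then show "wperm ?s \<otimes>\<^bsub>W\<^esub> wperm ?t =
        wperm (transpose a b \<circ> transpose x y) \<otimes>\<^bsub>W\<^esub> (wperm ?t \<otimes>\<^bsub>W\<^esub> wperm ?s)"
      by (simp flip: wperm_comp)
  qed (auto intro: perm_swaps)
  have swaps: "wperm (transpose a b \<circ> transpose c e) \<in> derived W H" if "a \<noteq> b" "c \<noteq> e" for a b c e
  proof -
    \<comment> \<open>The two transpositions may overlap. Inserting the fresh transposition (x x+1)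
      twice splits their product into two pairs of disjoint ones.\<close>
    define x where "x = Suc (a + b + c + e)"
    have w: "wperm (transpose a b \<circ> transpose x (Suc x)) \<in> derived W H"
        "wperm (transpose x (Suc x) \<circ> transpose c e) \<in> derived W H"
      using that by (auto simp: x_def intro!: disj)
    have eq: "transpose a b \<circ> transpose c e =
        (transpose a b \<circ> transpose x (Suc x)) \<circ> (transpose x (Suc x) \<circ> transpose c e)"
      by (simp add: fun_eq_iff)
    show ?thesis
      unfolding eq wperm_comp[of "transpose a b \<circ> transpose x (Suc x)"]
      using w by (rule D_closed)
  qed
  \<comment> \<open>An even number of transpositions is peeled off two at a time, and each pair is
    covered by \<open>swaps\<close>.\<close>
  have even: "wperm \<sigma> \<in> derived W H" if "swapidseq k \<sigma>" "even k" for k \<sigma>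
    using that
  proof (induction k arbitrary: \<sigma> rule: less_induct)
    case (less k)
    show ?case
    proof (cases "k = 0")
      case True
      have "wperm id = \<one>\<^bsub>W\<^esub>"
        by (simp add: wperm_def wreath_one)
      then show ?thesis
        using less.prems(1) True subgroup.one_closed[OF sub] by (metis swapidseq_id_iff)
    next
      case False
      then have "\<exists>m. k = Suc (Suc m)"
        using less.prems(2) by presburger
      then obtain m where k: "k = Suc (Suc m)" ..
      obtain a b p where ab: "\<sigma> = transpose a b \<circ> p" "swapidseq (Suc m) p" "a \<noteq> b"
        using less.prems(1) k by (auto elim: swapidseq.cases)
      obtain c e q where ce: "p = transpose c e \<circ> q" "swapidseq m q" "c \<noteq> e"
        using ab(2) by (auto elim: swapidseq.cases)
      have eq: "\<sigma> = (transpose a b \<circ> transpose c e) \<circ> q"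
        by (simp add: ab ce o_assoc)
      have "wperm q \<in> derived W H"
        using less.IH[of m q] less.prems(2) ce(2) k by simp
      then show ?thesis
        unfolding eq wperm_comp[of _ q] using swaps[OF ab(3) ce(3)] by (intro D_closed)
    qed
  qed
  show ev: "wperm \<sigma> \<in> derived W H" if "permutation \<sigma>" "evenperm \<sigma>" for \<sigma>
    using that even evenperm_unique unfolding permutation_def by metis
  show d2: "wdiag2 i j u \<in> derived W H" if "i \<noteq> j" "u \<in> carrier G" for i j u
  proof -
    \<comment> \<open>All spare indices are fresh. \<open>k\<close> absorbs \<open>inv u\<close>,
      giving \<open>X\<close> product 1, and (x x+1) makes the swap of \<open>i\<close> and
      \<open>j\<close> even. Conjugation by \<open>p\<close> moves \<open>u\<close> from
      \<open>i\<close> to \<open>j\<close> and fixes \<open>k\<close>, so the commutator of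
      \<open>X\<close> and \<open>p\<close> is \<open>Z\<close>.\<close>
    define k x where "k = Suc (i + j)" and "x = Suc k"
    define p where "p = transpose i j \<circ> transpose x (Suc x)"
    define X where "X = (\<lambda>_. \<one>)(i := u, k := inv u)"
    define Z where "Z = (\<lambda>_. \<one>)(i := u, j := inv u)"
    have neq: "i \<noteq> k" "j \<noteq> k" "i \<noteq> x" "j \<noteq> x" "k \<noteq> x" "i \<noteq> Suc x" "j \<noteq> Suc x" "k \<noteq> Suc x"
      by (auto simp: k_def x_def)
    have p: "p i = j" "p j = i" "p k = k"
      using neq by (auto simp: p_def transpose_def)
    have p_other: "p m \<notin> {i, j, k}" if "m \<notin> {i, j, k}" for m
      using that neq by (auto simp: p_def transpose_def)
    have "p \<circ> p = id"
    proof
      fix m show "(p \<circ> p) m = id m"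
        using neq by (cases "m = i"; cases "m = j"; simp add: p_def transpose_def)
    qed
    then have inv_p: "inv_into UNIV p = p"
      by (intro inv_unique_comp)
    have X: "X m \<in> carrier G" and Z: "Z m \<in> carrier G" for m
      using that by (auto simp: X_def Z_def)
    \<comment> \<open>The commutator identity read entry by entry; as \<open>p\<close> is an
      involution, conjugation by it reads the entry at \<open>p m\<close>.\<close>
    have XZ: "X m = Z m \<otimes> X (p m)" for m
    proof (cases "m \<in> {i, j, k}")
      case True
      then consider "m = i" | "m = j" | "m = k"
        by blast
      then show ?thesis
        using that neq p by cases (simp_all add: X_def Z_def)
    next
      case False
      then show ?thesis
        using p_other[OF False] by (simp add: X_def Z_def)
    qed
    have wdiag2: "wdiag2 i k u = (X, id)" "wdiag2 i j u = (Z, id)"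
      by (simp_all add: wdiag2_def X_def Z_def)
    show ?thesis
    proof (rule W.commutator_in_derived[OF H])
      show "wdiag2 i k u \<in> H"
        using that neq by (auto intro!: diag2)
      show "wperm p \<in> H"
        using that unfolding p_def by (auto intro!: perm perm_swaps even_swaps)
      show "wdiag2 i k u \<otimes>\<^bsub>W\<^esub> wperm p = wdiag2 i j u \<otimes>\<^bsub>W\<^esub> (wperm p \<otimes>\<^bsub>W\<^esub> wdiag2 i k u)"
        using X Z by (simp add: wdiag2 wperm_def inv_p XZ[symmetric])
    qed (use that in auto)
  qed
  have inv_cancel: "inv a \<otimes> (a \<otimes> b) = b" if "a \<in> carrier G" "b \<in> carrier G" for a b
    using that by (simp add: m_assoc[symmetric])
  \<comment> \<open>For c = [u, v] the inverses of \<open>u\<close> and \<open>v\<close> are placed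
    at different indices, where they commute with everything: [diag(u, u^-1, 1), diag(v, 1, v^-1)] =
    diag(c, 1, 1).\<close>
  have d1: "wdiag i c \<in> derived W H" if "c \<in> derived G (carrier G)" for i c
    using that unfolding derived_def[of G]
  proof (induction rule: generate.induct)
    case one
    then show ?case
      using subgroup.one_closed[OF sub] by (simp add: wdiag_def wreath_one fun_upd_idem)
  next
    case (incl c)
    then obtain u v where uv: "u \<in> carrier G" "v \<in> carrier G" "c = u \<otimes> v \<otimes> inv u \<otimes> inv v"
      by blast
    show ?case
    proof (rule W.commutator_in_derived[OF H])
      show "wdiag2 i (Suc i) u \<in> H" "wdiag2 i (Suc (Suc i)) v \<in> H"
        using uv by (auto intro!: diag2)
      show "wdiag2 i (Suc i) u \<otimes>\<^bsub>W\<^esub> wdiag2 i (Suc (Suc i)) v =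
          wdiag i c \<otimes>\<^bsub>W\<^esub> (wdiag2 i (Suc (Suc i)) v \<otimes>\<^bsub>W\<^esub> wdiag2 i (Suc i) u)"
        using uv by (auto simp: wdiag_def wdiag2_def fun_eq_iff m_assoc inv_cancel)
    qed (use uv in auto)
  next
    \<comment> \<open>The inverse of [u, v] is [v, u], so the two diagonals exchange their
      roles.\<close>
    case (inv c)
    then obtain u v where uv: "u \<in> carrier G" "v \<in> carrier G" "c = u \<otimes> v \<otimes> inv u \<otimes> inv v"
      by blast
    show ?case
    proof (rule W.commutator_in_derived[OF H])
      show "wdiag2 i (Suc i) v \<in> H" "wdiag2 i (Suc (Suc i)) u \<in> H"
        using uv by (auto intro!: diag2)
      show "wdiag2 i (Suc i) v \<otimes>\<^bsub>W\<^esub> wdiag2 i (Suc (Suc i)) u =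
          wdiag i (inv c) \<otimes>\<^bsub>W\<^esub> (wdiag2 i (Suc (Suc i)) u \<otimes>\<^bsub>W\<^esub> wdiag2 i (Suc i) v)"
        using uv by (auto simp: wdiag_def wdiag2_def fun_eq_iff m_assoc inv_mult_group inv_cancel)
    qed (use uv in auto)
  next
    case (eng c c')
    have "c \<in> carrier G" "c' \<in> carrier G"
      using eng.hyps derived_in_carrier[of "carrier G"] by (auto simp: derived_def)
    then have "wdiag i (c \<otimes> c') = wdiag i c \<otimes>\<^bsub>W\<^esub> wdiag i c'"
      by (auto simp: wdiag_def fun_eq_iff)
    then show ?case
      using D_closed eng.IH by simp
  qed
  show "(d, \<sigma>) \<in> derived W H"
    if lev: "(d, \<sigma>) \<in> wreath_level G n" and "evenperm \<sigma>" and
      prod: "list_prod G d n \<in> derived G (carrier G)" for d \<sigma> n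
  proof -
    have d: "d i \<in> carrier G" for i
      using lev by (simp add: wreath_level_def)
    let ?c = "list_prod G d"
    have c: "?c k \<in> carrier G" for k
      using d by (rule list_prod_closed)
    \<comment> \<open>A telescope: position \<open>k\<close> stores the inverse of the partial
      product. Multiplying by \<open>wdiag2 k (Suc k) (?c (Suc k))\<close> turns that entry into
      \<open>d k\<close> and passes the new inverse on to \<open>Suc k\<close>.\<close>
    have tel: "(\<lambda>i. if i < k then d i else if i = k then inv (?c k) else \<one>, id) \<in> derived W H" for k
    proof (induction k)
      case 0
      have "(\<lambda>i. if i < 0 then d i else if i = 0 then inv (?c 0) else \<one>, id) = \<one>\<^bsub>W\<^esub>"
        by (auto simp: wreath_one)
      then show ?case
        using subgroup.one_closed[OF sub] by (simp only:)
    next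
      case (Suc k)
      have "inv (?c k) \<otimes> ?c (Suc k) = d k"
        unfolding list_prod_Suc[OF d] using d c by (simp add: m_assoc[symmetric])
      then have eq: "(\<lambda>i. if i < Suc k then d i else if i = Suc k then inv (?c (Suc k)) else \<one>, id) =
          (\<lambda>i. if i < k then d i else if i = k then inv (?c k) else \<one>, id)
            \<otimes>\<^bsub>W\<^esub> wdiag2 k (Suc k) (?c (Suc k))"
        using d c[of k] c[of "Suc k"]
        by (auto simp: wdiag2_def fun_eq_iff less_Suc_eq simp del: upt_Suc)
      show ?case
        unfolding eq by (intro D_closed Suc.IH d2 c) simp
    qed
    \<comment> \<open>The telescope leaves \<open>inv (?c n)\<close> at index \<open>n\<close>;
      \<open>wdiag\<close> cancels it, and this is where the total product has to lie in the derived
      subgroup of \<open>G\<close>.\<close>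
    have "(d, \<sigma>) = (\<lambda>i. if i < n then d i else if i = n then inv (?c n) else \<one>, id)
        \<otimes>\<^bsub>W\<^esub> wdiag n (?c n) \<otimes>\<^bsub>W\<^esub> wperm \<sigma>"
      using lev c[of n] by (auto simp: wdiag_def wperm_def wreath_level_def fun_eq_iff)
    moreover have "permutation \<sigma>"
      using lev by (auto simp: wreath_level_def permutation_permutes)
    ultimately show ?thesis
      using D_closed tel d1[OF prod] ev \<open>evenperm \<sigma>\<close> by simp
  qed
qed

section \<open>Invariants bounding the derived subgroup from above\<close>

lemma evenperm_derived_wreath:
  assumes "(d, \<sigma>) \<in> derived W (carrier W)"
  shows "evenperm \<sigma>"
proof -
  \<comment> \<open>Equality as multiplication makes \<open>bool\<close> the group of order two with
    unit \<open>True\<close>, so that \<open>evenperm\<close> itself is the sign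
    homomorphism.\<close>
  define B :: "bool monoid" where "B = \<lparr>carrier = UNIV, mult = (=), one = True\<rparr>"
  have B: "comm_group B"
    by (rule comm_groupI) (auto simp: B_def)
  have "group_hom W B (\<lambda>x. evenperm (snd x))"
  proof (intro group_hom.intro group_hom_axioms.intro homI)
    fix x y assume "x \<in> carrier W" "y \<in> carrier W"
    then obtain n where "x \<in> wreath_level G n" "y \<in> wreath_level G n"
      by (rule wreath_carrier_common_level)
    then have "permutation (snd x)" "permutation (snd y)"
      by (auto simp: wreath_level_def permutation_permutes)
    then show "evenperm (snd (x \<otimes>\<^bsub>W\<^esub> y)) = evenperm (snd x) \<otimes>\<^bsub>B\<^esub> evenperm (snd y)"
      by (cases x; cases y) (simp add: B_def evenperm_comp)
  qed (use B in \<open>auto simp: group_wreath comm_group_def B_def\<close>)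
  from group_hom.hom_derived_eq_one[OF this B assms] show ?thesis
    by (simp add: B_def)
qed

text \<open>Modulo \<open>[G, G]\<close> the factors commute, so the total product is insensitive to
  permuting the entries and becomes a homomorphism on \<open>W\<close>; it kills the derived
  subgroup.\<close>

lemma list_prod_derived_wreath:
  assumes "(d, \<sigma>) \<in> derived W (carrier W)" "(d, \<sigma>) \<in> wreath_level G n"
  shows "list_prod G d n \<in> derived G (carrier G)"
proof -
  let ?D = "derived G (carrier G)"
  interpret D: normal ?D G by (rule derived_self_is_normal)
  define Q where "Q = G Mod ?D"
  interpret Q: comm_group Q
    unfolding Q_def by (rule derived_quot_is_comm_group)
  define q where "q = (\<lambda>a. ?D #> a)"
  have q_closed: "q a \<in> carrier Q" if "a \<in> carrier G" for a
    using that by (auto simp: Q_def q_def FactGroup_def RCOSETS_def)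
  have q_mult: "q (a \<otimes> b) = q a \<otimes>\<^bsub>Q\<^esub> q b" if "a \<in> carrier G" "b \<in> carrier G" for a b
    using that by (simp add: Q_def q_def FactGroup_def D.rcos_sum)
  have q_one: "q \<one> = \<one>\<^bsub>Q\<^esub>"
    by (simp add: Q_def q_def FactGroup_def coset_mult_one D.subset)
  \<comment> \<open>Multiplying over the support makes \<open>\<phi>\<close> independent of the
    level; by \<open>\<phi>_level\<close> any level of \<open>x\<close> may be used to compute
    it.\<close>
  define \<phi> where "\<phi> = (\<lambda>x :: (nat \<Rightarrow> 'a) \<times> (nat \<Rightarrow> nat). finprod Q (\<lambda>i. q (fst x i)) {i. fst x i \<noteq> \<one>})"
  have \<phi>_level: "\<phi> x = finprod Q (\<lambda>i. q (fst x i)) {..<n}" if "x \<in> wreath_level G n" for x n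
    unfolding \<phi>_def
  proof (rule Q.finprod_mono_neutral_cong_left)
    show "{i. fst x i \<noteq> \<one>} \<subseteq> {..<n}"
      using that by (auto simp: wreath_level_def not_le[symmetric])
  qed (use that in \<open>auto simp: wreath_level_def q_one q_closed\<close>)
  have "group_hom W Q \<phi>"
  proof (intro group_hom.intro group_hom_axioms.intro homI)
    fix x assume "x \<in> carrier W"
    then obtain d \<sigma> n where "x = (d, \<sigma>)" "(d, \<sigma>) \<in> wreath_level G n"
      by (rule wreath_carrierE)
    then show "\<phi> x \<in> carrier Q"
      by (auto simp: \<phi>_level wreath_level_def q_closed intro!: Q.finprod_closed)
  next
    fix x y assume "x \<in> carrier W" "y \<in> carrier W"
    then obtain n where lev: "x \<in> wreath_level G n" "y \<in> wreath_level G n"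
      by (rule wreath_carrier_common_level)
    obtain d \<sigma> e \<tau> where xy: "x = (d, \<sigma>)" "y = (e, \<tau>)"
      by (cases x; cases y)
    have cl: "d i \<in> carrier G" "e i \<in> carrier G" for i
      using lev by (auto simp: xy wreath_level_def)
    have p: "inv_into UNIV \<sigma> permutes {..<n}"
      using lev by (auto simp: xy wreath_level_def permutes_inv)
    have "\<phi> (x \<otimes>\<^bsub>W\<^esub> y) = finprod Q (\<lambda>i. q (d i) \<otimes>\<^bsub>Q\<^esub> q (e (inv_into UNIV \<sigma> i))) {..<n}"
      using \<phi>_level[OF wreath_level_mult[OF lev]] by (simp add: xy q_mult cl)
    also have "\<dots> = finprod Q (\<lambda>i. q (d i)) {..<n} \<otimes>\<^bsub>Q\<^esub>
        finprod Q (\<lambda>i. q (e (inv_into UNIV \<sigma> i))) {..<n}"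
      by (rule Q.finprod_multf) (auto simp: q_closed cl)
    \<comment> \<open>The twist in the wreath product only reindexes a commutative product.\<close>
    also have "finprod Q (\<lambda>i. q (e (inv_into UNIV \<sigma> i))) {..<n} =
        finprod Q (\<lambda>i. q (e i)) (inv_into UNIV \<sigma> ` {..<n})"
      using p by (intro Q.finprod_reindex[symmetric]) (auto simp: q_closed cl permutes_inj_on)
    also have "inv_into UNIV \<sigma> ` {..<n} = {..<n}"
      using p by (rule permutes_image)
    finally show "\<phi> (x \<otimes>\<^bsub>W\<^esub> y) = \<phi> x \<otimes>\<^bsub>Q\<^esub> \<phi> y"
      using lev \<phi>_level by (simp add: xy)
  qed (auto simp: group_wreath Q.group_axioms)
  then have "\<phi> (d, \<sigma>) = \<one>\<^bsub>Q\<^esub>"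
    using Q.comm_group_axioms assms(1) by (rule group_hom.hom_derived_eq_one)
  moreover have d: "d i \<in> carrier G" for i
    using assms(2) by (simp add: wreath_level_def)
  have "q (list_prod G d k) = finprod Q (\<lambda>i. q (d i)) {..<k}" for k
  proof (induction k)
    case (Suc k)
    have "q (list_prod G d (Suc k)) = q (list_prod G d k) \<otimes>\<^bsub>Q\<^esub> q (d k)"
      unfolding list_prod_Suc[OF d] using d by (simp add: q_mult list_prod_closed)
    then show ?case
      using Suc d by (simp add: lessThan_Suc q_closed Q.m_comm del: upt_Suc)
  qed (simp add: q_one)
  ultimately have "q (list_prod G d n) = ?D"
    using \<phi>_level[OF assms(2)] by (simp add: Q_def FactGroup_def)
  then show ?thesis
    using D.subgroup_axioms d unfolding q_def by (metis list_prod_closed coset_join1 D.subset)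
qed

lemma derived_wreath_iff:
  assumes "(d, \<sigma>) \<in> wreath_level G n"
  shows "(d, \<sigma>) \<in> derived W (carrier W) \<longleftrightarrow> evenperm \<sigma> \<and> list_prod G d n \<in> derived G (carrier G)"
  using assms evenperm_derived_wreath list_prod_derived_wreath derived_wreath_in[of "carrier W" d \<sigma> n]
  by auto

text \<open>The two generating families already lie in \<open>?E\<close>, and each element of
  \<open>?E\<close> has trivial invariants, so the lower bound applies again with
  \<open>H = ?E\<close>.\<close>

lemma perfect_derived_wreath: "derived W (derived W (carrier W)) = derived W (carrier W)"
proof
  interpret W: group W by (rule group_wreath)
  let ?E = "derived W (carrier W)"
  have E: "?E \<subseteq> carrier W"
    by (rule W.derived_in_carrier) simp
  then show "derived W ?E \<subseteq> ?E"
    by (rule W.mono_derived)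
  show "?E \<subseteq> derived W ?E"
  proof
    fix x assume x: "x \<in> ?E"
    then obtain d \<sigma> n where x': "x = (d, \<sigma>)" and lev: "(d, \<sigma>) \<in> wreath_level G n"
      using E by (meson subsetD wreath_carrierE)
    show "x \<in> derived W ?E"
      unfolding x'
    proof (rule derived_wreath_in[OF E _ _ lev])
      show "wperm \<tau> \<in> ?E" if "permutation \<tau>" "evenperm \<tau>" for \<tau>
        using that by (intro derived_wreath_even) auto
      show "wdiag2 i j u \<in> ?E" if "i \<noteq> j" "u \<in> carrier G" for i j u
        using that by (intro derived_wreath_diag2) auto
    qed (use x derived_wreath_iff[OF lev] in \<open>auto simp: x'\<close>)
  qed
qed

end

section \<open>Monomial matrices\<close>

context monoid_with_zero
begin

abbreviation "R \<equiv> reduced_ring A z"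

abbreviation "U \<equiv> units_of A"

abbreviation "\<epsilon> \<equiv> emb A z"

section \<open>The embedding of \<open>A\<close> into the ring\<close>

lemma emb_closed [simp, intro]: "a \<in> carrier A \<Longrightarrow> \<epsilon> a \<in> carrier R"
  and emb_mult: "a \<in> carrier A \<Longrightarrow> b \<in> carrier A \<Longrightarrow> \<epsilon> a \<otimes>\<^bsub>R\<^esub> \<epsilon> b = \<epsilon> (a \<otimes> b)"
  and emb_one: "\<one>\<^bsub>R\<^esub> = \<epsilon> \<one>"
  and emb_zero: "\<zero>\<^bsub>R\<^esub> = \<epsilon> z"
proof -
  interpret I: ideal "zero_ideal z" "monoid_ring A"
    by (rule ideal_zero_ideal)
  have hom: "(+>\<^bsub>monoid_ring A\<^esub>) (zero_ideal z) \<in> ring_hom (monoid_ring A) R"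
    unfolding reduced_ring_def by (rule I.rcos_ring_hom)
  have frag: "frag_of a \<in> carrier (monoid_ring A)" if "a \<in> carrier A" for a
    using that by (simp add: monoid_ring_def)
  show "\<epsilon> a \<in> carrier R" if "a \<in> carrier A"
    using ring_hom_closed[OF hom frag[OF that]] by (simp add: emb_def)
  show "\<epsilon> a \<otimes>\<^bsub>R\<^esub> \<epsilon> b = \<epsilon> (a \<otimes> b)" if "a \<in> carrier A" "b \<in> carrier A"
    using ring_hom_mult[OF hom frag[OF that(1)] frag[OF that(2)]]
    by (simp add: emb_def monoid_ring_def)
  show "\<one>\<^bsub>R\<^esub> = \<epsilon> \<one>"
    using ring_hom_one[OF hom] by (simp add: emb_def monoid_ring_def)
  have "frag_of z \<in> zero_ideal z"
    unfolding zero_ideal_def by (rule range_eqI[of _ _ 1]) simp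
  then show "\<zero>\<^bsub>R\<^esub> = \<epsilon> z"
    using I.a_rcos_const by (simp add: emb_def reduced_ring_def FactRing_def)
qed

lemma emb_inject:
  assumes "a \<in> carrier A" "b \<in> carrier A"
  shows "\<epsilon> a = \<epsilon> b \<longleftrightarrow> a = b"
proof
  interpret I: ideal "zero_ideal z" "monoid_ring A"
    by (rule ideal_zero_ideal)
  assume eq: "\<epsilon> a = \<epsilon> b"
  have "frag_of a \<in> \<epsilon> a"
    unfolding emb_def using assms by (intro I.a_rcos_self) (simp add: monoid_ring_def)
  then obtain k where "frag_of a = frag_cmul k (frag_of z) + frag_of b"
    unfolding eq by (auto simp: emb_def a_r_coset_def' zero_ideal_def monoid_ring_def)
  then have "Poly_Mapping.lookup (frag_of a) x =
      k * Poly_Mapping.lookup (frag_of z) x + Poly_Mapping.lookup (frag_of b) x" for x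
    by (simp add: lookup_add)
  \<comment> \<open>If \<open>a\<close> and \<open>b\<close> differed, the coefficient at
    \<open>a\<close> would force \<open>z = a\<close> and the one at \<open>b\<close> would force
    \<open>z = b\<close>.\<close>
  from this[of a] this[of b] show "a = b"
    by (auto simp:  split: if_splits)
qed simp

lemma emb_eq_zero_iff: "a \<in> carrier A \<Longrightarrow> \<epsilon> a = \<zero>\<^bsub>R\<^esub> \<longleftrightarrow> a = z"
  by (simp add: emb_zero emb_inject zero_closed)

section \<open>Monomial matrices as images of wreath product elements\<close>

definition monomial :: "(nat \<Rightarrow> 'a) \<times> (nat \<Rightarrow> nat) \<Rightarrow> nat \<Rightarrow> nat \<Rightarrow> ('a \<Rightarrow>\<^sub>0 int) set" where
  "monomial = (\<lambda>(d, \<sigma>) i j. if i = \<sigma> j then \<epsilon> (d i) else \<zero>\<^bsub>R\<^esub>)"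

definition monomial_n :: "nat \<Rightarrow> (nat \<Rightarrow> 'a) \<times> (nat \<Rightarrow> nat) \<Rightarrow> nat \<Rightarrow> nat \<Rightarrow> ('a \<Rightarrow>\<^sub>0 int) set" where
  "monomial_n n x = (\<lambda>i\<in>{..<n}. \<lambda>j\<in>{..<n}. monomial x i j)"

lemma wreath_level_units:
  "(d, \<sigma>) \<in> wreath_level U n \<longleftrightarrow>
    (\<forall>i. d i \<in> Units A) \<and> (\<forall>i\<ge>n. d i = \<one>) \<and> \<sigma> permutes {..<n}"
  by (simp add: wreath_level_def units_of_carrier units_of_one)

text \<open>The case of \<open>l\<close> outside \<open>S\<close> covers \<open>1 = 0\<close>, where
  the row supports over which \<open>GL\<close> sums are empty.\<close>

lemma finsum_single:
  assumes "finite S" "\<And>k. k \<in> S \<Longrightarrow> k \<noteq> l \<Longrightarrow> f k = \<zero>\<^bsub>R\<^esub>" "l \<notin> S \<Longrightarrow> f l = \<zero>\<^bsub>R\<^esub>" "f l \<in> carrier R"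
  shows "(\<Oplus>\<^bsub>R\<^esub>k\<in>S. f k) = f l"
proof -
  interpret R: ring R by (rule ring_reduced_ring)
  show ?thesis
  proof (cases "l \<in> S")
    case True
    have "(\<Oplus>\<^bsub>R\<^esub>k\<in>S. f k) = (\<Oplus>\<^bsub>R\<^esub>k\<in>S. if l = k then f k else \<zero>\<^bsub>R\<^esub>)"
      using assms by (intro R.finsum_cong') auto
    also have "\<dots> = f l"
    proof (rule R.finsum_singleton[OF True assms(1)])
      show "f \<in> S \<rightarrow> carrier R"
        using assms by (metis Pi_I R.zero_closed)
    qed
    finally show ?thesis .
  next
    case False
    then have "(\<Oplus>\<^bsub>R\<^esub>k\<in>S. f k) = (\<Oplus>\<^bsub>R\<^esub>k\<in>S. \<zero>\<^bsub>R\<^esub>)"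
      using assms by (intro R.finsum_cong') auto
    then show ?thesis
      using False assms by simp
  qed
qed

lemma monomial_closed:
  assumes "x \<in> carrier (wreath U)"
  shows "monomial x i j \<in> \<epsilon> ` carrier A" "monomial x i j \<in> carrier R"
proof -
  show "monomial x i j \<in> \<epsilon> ` carrier A"
    using assms zero_closed
    by (auto elim!: wreath_carrierE simp: wreath_level_units monomial_def emb_zero Units_closed)
  then show "monomial x i j \<in> carrier R"
    by auto
qed

text \<open>Row \<open>i\<close> of D(d)\<sigma> can be nonzero only in column
  \<open>inv_into UNIV \<sigma> i\<close>, so at most one term survives. \<open>S\<close> is general
  in order to serve both products: the row support in \<open>GL\<close> and \<open>{..<n}\<close> in
  \<open>Mn\<close>.\<close>

lemma monomial_mult:
  assumes x: "(d, \<sigma>) \<in> carrier (wreath U)" and y: "y \<in> carrier (wreath U)"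
    and S: "finite S" "inv_into UNIV \<sigma> i \<notin> S \<Longrightarrow> monomial (d, \<sigma>) i (inv_into UNIV \<sigma> i) = \<zero>\<^bsub>R\<^esub>"
  shows "(\<Oplus>\<^bsub>R\<^esub>k\<in>S. monomial (d, \<sigma>) i k \<otimes>\<^bsub>R\<^esub> monomial y k j) =
    monomial ((d, \<sigma>) \<otimes>\<^bsub>wreath U\<^esub> y) i j"
proof -
  interpret R: ring R by (rule ring_reduced_ring)
  obtain e \<tau> where y': "y = (e, \<tau>)"
    by (cases y)
  have bij: "bij \<sigma>" and cl: "d k \<in> carrier A" "e k \<in> carrier A" for k
    using x y by (auto elim!: wreath_carrierE simp: y' wreath_level_units permutes_bij Units_closed)
  let ?l = "inv_into UNIV \<sigma> i"
  have l: "i = \<sigma> k \<longleftrightarrow> k = ?l" for k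
    using bij by (metis bij_inv_eq_iff)
  have "(\<Oplus>\<^bsub>R\<^esub>k\<in>S. monomial (d, \<sigma>) i k \<otimes>\<^bsub>R\<^esub> monomial y k j) =
      monomial (d, \<sigma>) i ?l \<otimes>\<^bsub>R\<^esub> monomial y ?l j"
  proof (rule finsum_single[OF S(1)])
    show "monomial (d, \<sigma>) i k \<otimes>\<^bsub>R\<^esub> monomial y k j = \<zero>\<^bsub>R\<^esub>" if "k \<noteq> ?l" for k
      using that l monomial_closed[OF y] by (simp add: monomial_def split: prod.split)
  qed (use S(2) monomial_closed[OF x] monomial_closed[OF y] in auto)
  also have "\<dots> = monomial ((d, \<sigma>) \<otimes>\<^bsub>wreath U\<^esub> y) i j"
    using l cl by (auto simp: monomial_def y' emb_mult units_of_mult)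
  finally show ?thesis .
qed

text \<open>Enlarging the carrier to \<open>UNIV\<close> makes closure trivial at a stage where the
  carrier of \<open>GL\<close> is not yet known to be the image; \<open>carrier_GL\<close> settles
  that later.\<close>

lemma monomial_hom: "monomial \<in> hom (wreath U) (GL A z\<lparr>carrier := UNIV\<rparr>)"
proof (rule homI)
  fix x y assume x: "x \<in> carrier (wreath U)" and y: "y \<in> carrier (wreath U)"
  obtain d \<sigma> where x': "x = (d, \<sigma>)"
    by (cases x)
  have bij: "bij \<sigma>"
    using x by (auto elim!: wreath_carrierE simp: x' wreath_level_units permutes_bij)
  have "(\<Oplus>\<^bsub>R\<^esub>k\<in>{k. monomial x i k \<noteq> \<zero>\<^bsub>R\<^esub>}. monomial x i k \<otimes>\<^bsub>R\<^esub> monomial y k j) =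
      monomial (x \<otimes>\<^bsub>wreath U\<^esub> y) i j" for i j
    unfolding x'
  proof (rule monomial_mult)
    show "finite {k. monomial (d, \<sigma>) i k \<noteq> \<zero>\<^bsub>R\<^esub>}"
      by (rule finite_subset[of _ "{inv_into UNIV \<sigma> i}"])
        (use bij in \<open>auto simp: monomial_def bij_is_inj split: if_splits\<close>)
  qed (use x y x' in auto)
  then show "monomial (x \<otimes>\<^bsub>wreath U\<^esub> y) =
      monomial x \<otimes>\<^bsub>GL A z\<lparr>carrier := UNIV\<rparr>\<^esub> monomial y"
    by (simp add: GL_def Let_def)
qed simp

lemma monomial_one: "monomial \<one>\<^bsub>wreath U\<^esub> = \<one>\<^bsub>GL A z\<^esub>"
  by (simp add: monomial_def wreath_one GL_def Let_def units_of_one emb_one fun_eq_iff)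

lemma monomial_n_mult:
  assumes x: "x \<in> wreath_level U n" and y: "y \<in> wreath_level U n"
  shows "monomial_n n x \<otimes>\<^bsub>Mn A z n\<^esub> monomial_n n y = monomial_n n (x \<otimes>\<^bsub>wreath U\<^esub> y)"
proof -
  interpret R: ring R by (rule ring_reduced_ring)
  obtain d \<sigma> where x': "x = (d, \<sigma>)"
    by (cases x)
  have p: "inv_into UNIV \<sigma> permutes {..<n}"
    using x by (simp add: x' wreath_level_units permutes_inv)
  have "(\<Oplus>\<^bsub>R\<^esub>k\<in>{..<n}. monomial_n n x i k \<otimes>\<^bsub>R\<^esub> monomial_n n y k j) =
      monomial (x \<otimes>\<^bsub>wreath U\<^esub> y) i j" if "i < n" "j < n" for i j
  proof -
    have "(\<Oplus>\<^bsub>R\<^esub>k\<in>{..<n}. monomial_n n x i k \<otimes>\<^bsub>R\<^esub> monomial_n n y k j) =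
        (\<Oplus>\<^bsub>R\<^esub>k\<in>{..<n}. monomial x i k \<otimes>\<^bsub>R\<^esub> monomial y k j)"
      using that x y
      by (intro R.finsum_cong') (auto simp: monomial_n_def intro!: monomial_closed wreath_level_carrier)
    also have "\<dots> = monomial (x \<otimes>\<^bsub>wreath U\<^esub> y) i j"
      unfolding x' using that p x y permutes_in_image[OF p, of i]
      by (intro monomial_mult) (auto simp: x' intro: wreath_level_carrier)
    finally show ?thesis .
  qed
  then show ?thesis
    by (auto simp: Mn_def mats_def monomial_n_def[of n "x \<otimes>\<^bsub>wreath U\<^esub> y"] fun_eq_iff)
qed

lemma monomial_n_one: "monomial_n n \<one>\<^bsub>wreath U\<^esub> = \<one>\<^bsub>Mn A z n\<^esub>"
  by (auto simp: monomial_n_def monomial_def wreath_one Mn_def mats_def units_of_one emb_one fun_eq_iff)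

lemma monomial_n_in_Mn:
  assumes x: "x \<in> wreath_level U n"
  shows "monomial_n n x \<in> carrier (Mn A z n)"
proof -
  obtain d \<sigma> where x': "x = (d, \<sigma>)"
    by (cases x)
  have p: "\<sigma> permutes {..<n}"
    using x by (simp add: x' wreath_level_units)
  \<comment> \<open>The map required by \<open>Mn\<close> sends a row to its column, whereas
    \<sigma> sends a column to its row.\<close>
  have "inv_into UNIV \<sigma> \<in> {..<n} \<rightarrow> {..<n}"
    using permutes_in_image[OF permutes_inv[OF p]] by auto
  moreover have "\<forall>i<n. \<forall>j<n. inv_into UNIV \<sigma> i \<noteq> j \<longrightarrow> monomial_n n x i j = \<zero>\<^bsub>R\<^esub>"
    using p by (auto simp: x' monomial_n_def monomial_def permutes_inverses)
  ultimately show ?thesis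
    using monomial_closed(1)[OF wreath_level_carrier[OF x]]
    by (auto simp: Mn_def monomial_n_def)
qed

section \<open>Invertible matrices are monomial with unit entries\<close>

text \<open>In the entry \<open>(i, i)\<close> of MN = 1 only the term \<open>k = f i\<close> can
  survive, and it would vanish if \<open>g (f i)\<close> differed from \<open>i\<close>. Used for MN
  and for NM, this makes \<open>f\<close> and \<open>g\<close> mutually inverse and the entries
  units.\<close>

lemma Mn_mult_one_imp:
  assumes nontriv: "\<one> \<noteq> z"
    and f: "f \<in> {..<n} \<rightarrow> {..<n}" "\<forall>i<n. \<forall>j<n. f i \<noteq> j \<longrightarrow> M i j = \<zero>\<^bsub>R\<^esub>"
    and g: "\<forall>i<n. \<forall>j<n. g i \<noteq> j \<longrightarrow> N i j = \<zero>\<^bsub>R\<^esub>"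
    and a: "\<forall>i<n. a i \<in> carrier A \<and> M i (f i) = \<epsilon> (a i)"
    and b: "\<forall>i<n. b i \<in> carrier A \<and> N i (g i) = \<epsilon> (b i)"
    and MN: "M \<otimes>\<^bsub>Mn A z n\<^esub> N = \<one>\<^bsub>Mn A z n\<^esub>" and i: "i < n"
  shows "g (f i) = i \<and> a i \<otimes> b (f i) = \<one>"
proof -
  interpret R: ring R by (rule ring_reduced_ring)
  have fi: "f i < n"
    using f(1) i by auto
  have N: "N k j \<in> carrier R" if "k < n" "j < n" for k j
    using g b that by (cases "g k = j") auto
  have "\<one>\<^bsub>R\<^esub> = (\<Oplus>\<^bsub>R\<^esub>k\<in>{..<n}. M i k \<otimes>\<^bsub>R\<^esub> N k i)"
    using fun_cong[OF fun_cong[OF MN, of i], of i] i by (simp add: Mn_def mats_def)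
  also have "\<dots> = M i (f i) \<otimes>\<^bsub>R\<^esub> N (f i) i"
    using f fi i N a by (intro finsum_single) auto
  finally have eq: "\<one>\<^bsub>R\<^esub> = \<epsilon> (a i) \<otimes>\<^bsub>R\<^esub> N (f i) i"
    using a i by simp
  have gf: "g (f i) = i"
  proof (rule ccontr)
    assume "g (f i) \<noteq> i"
    then have "\<epsilon> \<one> = \<zero>\<^bsub>R\<^esub>"
      using eq g fi i a by (simp add: emb_one)
    then show False
      using nontriv by (simp add: emb_eq_zero_iff)
  qed
  then have "\<epsilon> \<one> = \<epsilon> (a i \<otimes> b (f i))"
    using eq a b i fi by (metis emb_mult emb_one)
  then show ?thesis
    using gf a b i fi by (simp add: emb_inject)
qed

lemma trivial_carrier: "\<one> = z \<Longrightarrow> a \<in> carrier A \<Longrightarrow> a = z"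
  by (metis r_one zero_mult_right)

lemma eq_monomial_nI:
  assumes "M \<in> {..<n} \<rightarrow>\<^sub>E ({..<n} \<rightarrow>\<^sub>E B)" "\<And>i j. i < n \<Longrightarrow> j < n \<Longrightarrow> M i j = monomial x i j"
  shows "M = monomial_n n x"
proof (intro ext)
  fix i j show "M i j = monomial_n n x i j"
  proof (cases "i < n")
    case True
    then have "M i \<in> {..<n} \<rightarrow>\<^sub>E B"
      using PiE_mem[OF assms(1)] by simp
    then show ?thesis
      using True assms(2) PiE_arb[of "M i" "{..<n}" _ j] by (cases "j < n") (auto simp: monomial_n_def)
  next
    case False
    then show ?thesis
      using PiE_arb[OF assms(1), of i] by (simp add: monomial_n_def)
  qed
qed

lemma GLn_imp_monomial:
  assumes M: "M \<in> carrier (GLn A z n)"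
  shows "\<exists>x\<in>wreath_level U n. M = monomial_n n x"
proof -
  obtain N where MN: "M \<in> carrier (Mn A z n)" "N \<in> carrier (Mn A z n)"
      "M \<otimes>\<^bsub>Mn A z n\<^esub> N = \<one>\<^bsub>Mn A z n\<^esub>" "N \<otimes>\<^bsub>Mn A z n\<^esub> M = \<one>\<^bsub>Mn A z n\<^esub>"
    using M by (auto simp: GLn_def units_of_carrier Units_def)
  have ext: "M \<in> {..<n} \<rightarrow>\<^sub>E ({..<n} \<rightarrow>\<^sub>E \<epsilon> ` carrier A)"
    and extN: "N \<in> {..<n} \<rightarrow>\<^sub>E ({..<n} \<rightarrow>\<^sub>E \<epsilon> ` carrier A)"
    using MN(1,2) by (simp_all add: Mn_def)
  have M_entry: "M i j \<in> \<epsilon> ` carrier A" and N_entry: "N i j \<in> \<epsilon> ` carrier A"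
    if "i < n" "j < n" for i j
    using PiE_mem[OF PiE_mem[OF ext]] PiE_mem[OF PiE_mem[OF extN]] that by simp_all
  show ?thesis
  proof (cases "\<one> = z")
    \<comment> \<open>If \<open>1 = 0\<close>, every entry is zero, so \<open>M\<close> equals the
      identity matrix.\<close>
    case True
    have "M = monomial_n n \<one>\<^bsub>wreath U\<^esub>"
    proof (rule eq_monomial_nI[OF ext])
      fix i j assume "i < n" "j < n"
      then have "M i j = \<epsilon> z"
        using M_entry trivial_carrier[OF True] by blast
      then show "M i j = monomial \<one>\<^bsub>wreath U\<^esub> i j"
        by (simp add: monomial_def wreath_one units_of_one True emb_zero)
    qed
    moreover have "\<one>\<^bsub>wreath U\<^esub> \<in> wreath_level U n"
      by (simp add: wreath_one wreath_level_units units_of_one permutes_id)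
    ultimately show ?thesis
      by blast
  next
    case nontriv: False
    obtain f where f: "f \<in> {..<n} \<rightarrow> {..<n}" "\<forall>i<n. \<forall>j<n. f i \<noteq> j \<longrightarrow> M i j = \<zero>\<^bsub>R\<^esub>"
      using MN(1) by (auto simp: Mn_def)
    obtain g where g: "g \<in> {..<n} \<rightarrow> {..<n}" "\<forall>i<n. \<forall>j<n. g i \<noteq> j \<longrightarrow> N i j = \<zero>\<^bsub>R\<^esub>"
      using MN(2) by (auto simp: Mn_def)
    have "\<forall>i. \<exists>c. i < n \<longrightarrow> c \<in> carrier A \<and> M i (f i) = \<epsilon> c"
      using M_entry f(1) by blast
    then obtain a where a: "\<forall>i<n. a i \<in> carrier A \<and> M i (f i) = \<epsilon> (a i)"
      by metis
    have "\<forall>i. \<exists>c. i < n \<longrightarrow> c \<in> carrier A \<and> N i (g i) = \<epsilon> c"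
      using N_entry g(1) by blast
    then obtain b where b: "\<forall>i<n. b i \<in> carrier A \<and> N i (g i) = \<epsilon> (b i)"
      by metis
    have gf: "g (f i) = i" "a i \<otimes> b (f i) = \<one>" if "i < n" for i
      using Mn_mult_one_imp[OF nontriv f g(2) a b MN(3) that] by auto
    have fg: "f (g i) = i" "b i \<otimes> a (g i) = \<one>" if "i < n" for i
      using Mn_mult_one_imp[OF nontriv g f(2) b a MN(4) that] by auto
    have a_unit: "a i \<in> Units A" if "i < n" for i
    proof -
      have "f i < n"
        using f(1) that by auto
      then have "b (f i) \<otimes> a i = \<one>"
        using fg(2)[of "f i"] gf(1)[OF that] by simp
      then show ?thesis
        using a b gf(2)[OF that] \<open>f i < n\<close> that unfolding Units_def by blast
    qed
    \<comment> \<open>The permutation comes from \<open>g\<close>, the inverse of \<open>f\<close>,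
      since \<sigma> takes columns to rows; it is the identity from \<open>n\<close> on.\<close>
    define \<sigma> where "\<sigma> = (\<lambda>j. if j < n then g j else j)"
    define d where "d = (\<lambda>i. if i < n then a i else \<one>)"
    have "bij_betw g {..<n} {..<n}"
      using f(1) g(1) gf fg by (intro bij_betw_byWitness[of _ f]) auto
    then have "bij_betw \<sigma> {..<n} {..<n}"
      by (subst bij_betw_cong[of _ _ g]) (auto simp: \<sigma>_def)
    then have "\<sigma> permutes {..<n}"
      by (rule bij_imp_permutes) (simp add: \<sigma>_def)
    then have lev: "(d, \<sigma>) \<in> wreath_level U n"
      using a_unit by (auto simp: wreath_level_units d_def)
    have "M = monomial_n n (d, \<sigma>)"
    proof (rule eq_monomial_nI[OF ext])
      fix i j assume ij: "i < n" "j < n"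
      show "M i j = monomial (d, \<sigma>) i j"
      proof (cases "i = g j")
        case True
        then show ?thesis
          using ij a[rule_format, OF ij(1)] fg(1)[OF ij(2)] by (simp add: monomial_def \<sigma>_def d_def)
      next
        case False
        then have "f i \<noteq> j"
          using gf(1)[OF ij(1)] by auto
        then show ?thesis
          using ij f(2) False by (simp add: monomial_def \<sigma>_def)
      qed
    qed
    then show ?thesis
      using lev by blast
  qed
qed

text \<open>Conversely to \<open>GLn_imp_monomial\<close>, a wreath element has its inverse on the
  same level, and \<open>monomial_n\<close> carries that inverse into \<open>Mn\<close>.\<close>

lemma carrier_GLn: "carrier (GLn A z n) = monomial_n n ` wreath_level U n"
proof
  show "carrier (GLn A z n) \<subseteq> monomial_n n ` wreath_level U n"
    using GLn_imp_monomial by blast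
  interpret U: group U by (rule units_group)
  interpret W: group "wreath U" by (rule U.group_wreath)
  show "monomial_n n ` wreath_level U n \<subseteq> carrier (GLn A z n)"
  proof clarify
    fix d \<sigma> assume x: "(d, \<sigma>) \<in> wreath_level U n"
    then obtain y where y: "y \<in> wreath_level U n" "y \<otimes>\<^bsub>wreath U\<^esub> (d, \<sigma>) = \<one>\<^bsub>wreath U\<^esub>"
      using U.wreath_level_inverse by blast
    then have "(d, \<sigma>) \<otimes>\<^bsub>wreath U\<^esub> y = \<one>\<^bsub>wreath U\<^esub>"
      using x wreath_level_carrier W.inv_comm by metis
    then show "monomial_n n (d, \<sigma>) \<in> carrier (GLn A z n)"
      using x y monomial_n_mult monomial_n_one monomial_n_in_Mn
      unfolding GLn_def units_of_carrier Units_def by (smt (verit) mem_Collect_eq)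
  qed
qed

text \<open>The pair is trivial from \<open>n\<close> on, so its infinite matrix is already of the
  form diag(M, 1, 1, ...).\<close>

lemma stab_monomial_n:
  assumes "x \<in> wreath_level U n"
  shows "stab R n (monomial_n n x) = monomial x"
proof (intro ext)
  fix i j
  obtain d \<sigma> where x': "x = (d, \<sigma>)"
    by (cases x)
  have p: "\<sigma> permutes {..<n}" and d: "\<And>i. i \<ge> n \<Longrightarrow> d i = \<one>"
    using assms by (auto simp: x' wreath_level_units)
  show "stab R n (monomial_n n x) i j = monomial x i j"
    using permutes_in_image[OF p, of j] permutes_not_in[OF p, of j] d
    by (cases "j < n") (auto simp: stab_def monomial_n_def monomial_def x' emb_one)
qed

section \<open>The stable group as an image of the wreath product\<close>

lemma carrier_GL: "carrier (GL A z) = monomial ` carrier (wreath U)"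
proof -
  have "carrier (GL A z) = (\<Union>n\<in>{1..}. monomial ` wreath_level U n)"
    by (simp add: GL_def Let_def carrier_GLn image_image stab_monomial_n cong: image_cong)
  also have "\<dots> = monomial ` carrier (wreath U)"
  proof -
    \<comment> \<open>\<open>GL\<close> takes the union over \<open>n \<ge> 1\<close> while
      \<open>wreath\<close> starts at level 0; level 0 is absorbed by level 1.\<close>
    have "wreath_level U n \<subseteq> wreath_level U (Suc n)" for n
      by (rule wreath_level_mono) simp
    then show ?thesis
      by (fastforce simp: wreath_def)
  qed
  finally show ?thesis .
qed

text \<open>The group laws of \<open>GL\<close> are inherited: it is the image of a group under a
  multiplicative map, with unit the image of the unit.\<close>

lemma group_hom_monomial: "group_hom (wreath U) (GL A z) monomial"
proof -
  interpret U: group U by (rule units_group)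
  interpret W: group "wreath U" by (rule U.group_wreath)
  have "GL A z\<lparr>carrier := carrier (GL A z), one := \<one>\<^bsub>GL A z\<^esub>\<rparr> = GL A z"
    by (rule monoid.equality) simp_all
  then have "group (GL A z)"
    using W.hom_imp_img_group[OF monomial_hom] by (simp add: carrier_GL[symmetric] monomial_one)
  moreover have "monomial \<in> hom (wreath U) (GL A z)"
    using monomial_hom by (auto simp: hom_def carrier_GL)
  ultimately show ?thesis
    by (simp add: group_hom_def group_hom_axioms_def W.group_axioms)
qed

text \<open>\<open>monomial\<close> maps onto \<open>GL\<close>, and derived subgroups commute with
  homomorphic images.\<close>

lemma E_grp_eq: "E_grp A z = monomial ` derived (wreath U) (carrier (wreath U))"
  unfolding E_grp_def carrier_GL by (rule group_hom.derived_img[OF group_hom_monomial]) simp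

lemma perfect_E_grp: "derived (GL A z) (E_grp A z) = E_grp A z"
proof -
  interpret U: group U by (rule units_group)
  interpret W: group "wreath U" by (rule U.group_wreath)
  show ?thesis
    unfolding E_grp_eq
    by (simp add: group_hom.derived_img[OF group_hom_monomial] W.derived_in_carrier
        U.perfect_derived_wreath)
qed

text \<open>For \<open>1 \<noteq> 0\<close> units are nonzero, so the positions of the nonzero
  entries determine \<sigma>; as \<sigma> is surjective, every row then reveals its unit.\<close>

lemma inj_on_monomial:
  assumes "\<one> \<noteq> z"
  shows "inj_on monomial (carrier (wreath U))"
proof (rule inj_onI)
  fix x y assume xy: "x \<in> carrier (wreath U)" "y \<in> carrier (wreath U)" "monomial x = monomial y"
  obtain d \<sigma> e \<tau> where xy': "x = (d, \<sigma>)" "y = (e, \<tau>)"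
    by (cases x; cases y)
  have units: "d i \<in> Units A" "e i \<in> Units A" for i
    using xy by (auto elim!: wreath_carrierE simp: xy' wreath_level_units)
  have "surj \<sigma>"
    using xy by (auto elim!: wreath_carrierE simp: xy' wreath_level_units permutes_surj)
  have nz: "\<epsilon> u \<noteq> \<zero>\<^bsub>R\<^esub>" if "u \<in> Units A" for u
    using that assms by (metis Units_closed Units_l_inv Units_inv_closed emb_eq_zero_iff zero_mult_right)
  have eq: "(if i = \<sigma> j then \<epsilon> (d i) else \<zero>\<^bsub>R\<^esub>) = (if i = \<tau> j then \<epsilon> (e i) else \<zero>\<^bsub>R\<^esub>)" for i j
    using fun_cong[OF fun_cong[OF xy(3)]] by (simp add: xy' monomial_def)
  have st: "\<sigma> j = \<tau> j" for j
    using eq[of "\<sigma> j" j] nz units by (auto split: if_splits)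
  moreover have "d i = e i" for i
    using \<open>surj \<sigma>\<close> eq[of i] st units by (metis emb_inject Units_closed surj_def)
  ultimately show "x = y"
    by (simp add: xy' fun_eq_iff)
qed

text \<open>Only the values of \<open>a\<close> below \<open>n\<close> are constrained, so
  \<open>d\<close> pads with 1 to reach an element of level \<open>n\<close>; the matrix product is
  then computed in the wreath product.\<close>

lemma diag_mat_mult_perm_mat:
  assumes "\<sigma> permutes {..<n}" "\<forall>i<n. a i \<in> Units A"
  defines "d \<equiv> \<lambda>i. if i < n then a i else \<one>"
  shows "(d, \<sigma>) \<in> wreath_level U n"
    and "diag_mat A z n a \<otimes>\<^bsub>Mn A z n\<^esub> perm_mat R n \<sigma> = monomial_n n (d, \<sigma>)"
proof -
  have lev: "(d, id) \<in> wreath_level U n" "(\<lambda>_. \<one>, \<sigma>) \<in> wreath_level U n"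
    using assms by (auto simp: wreath_level_units permutes_id)
  have "diag_mat A z n a = monomial_n n (d, id)"
    by (auto simp: diag_mat_def monomial_n_def monomial_def d_def fun_eq_iff)
  moreover have "perm_mat R n \<sigma> = monomial_n n (\<lambda>_. \<one>, \<sigma>)"
    by (auto simp: perm_mat_def monomial_n_def monomial_def emb_one fun_eq_iff)
  ultimately have "diag_mat A z n a \<otimes>\<^bsub>Mn A z n\<^esub> perm_mat R n \<sigma> =
      monomial_n n ((d, id) \<otimes>\<^bsub>wreath U\<^esub> (\<lambda>_. \<one>, \<sigma>))"
    using monomial_n_mult[OF lev] by simp
  moreover have "(d, id) \<otimes>\<^bsub>wreath U\<^esub> (\<lambda>_. \<one>, \<sigma>) = (d, \<sigma>)"
    using assms by (auto simp: units_of_mult d_def fun_eq_iff Units_closed)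
  ultimately show "diag_mat A z n a \<otimes>\<^bsub>Mn A z n\<^esub> perm_mat R n \<sigma> = monomial_n n (d, \<sigma>)"
    by simp
  show "(d, \<sigma>) \<in> wreath_level U n"
    using assms by (auto simp: wreath_level_units)
qed

text \<open>If \<open>1 = 0\<close>, the matrix does not determine \<open>\<sigma>\<close>; the identity then serves as the even permutation.\<close>

lemma E_grp_imp_even_monomial:
  assumes M: "M \<in> carrier (GLn A z n)" and E: "stab R n M \<in> E_grp A z"
  obtains d \<sigma> where "(d, \<sigma>) \<in> wreath_level U n" "M = monomial_n n (d, \<sigma>)"
    "(d, \<sigma>) \<in> derived (wreath U) (carrier (wreath U))"
proof -
  interpret U: group U by (rule units_group)
  interpret W: group "wreath U" by (rule U.group_wreath)
  have sub: "derived (wreath U) (carrier (wreath U)) \<subseteq> carrier (wreath U)"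
    by (rule W.derived_in_carrier) simp
  obtain d \<sigma> where x: "(d, \<sigma>) \<in> wreath_level U n" "M = monomial_n n (d, \<sigma>)"
    using M by (auto simp: carrier_GLn)
  show ?thesis
  proof (cases "\<one> = z")
    case True
    have "Units A = {\<one>}"
      using trivial_carrier[OF True] True by auto
    then have "M = monomial_n n (\<lambda>_. \<one>, id)"
      using x by (auto simp: monomial_n_def monomial_def wreath_level_units emb_zero True fun_eq_iff)
    moreover have "(\<lambda>_. \<one>, id) \<in> derived (wreath U) (carrier (wreath U))"
      using subgroup.one_closed[OF W.derived_is_subgroup[OF order_refl]]
      by (simp add: wreath_one units_of_one)
    ultimately show ?thesis
      using that[of "\<lambda>_. \<one>" id] by (simp add: wreath_level_units permutes_id)
  next
    case False
    obtain y where y: "y \<in> derived (wreath U) (carrier (wreath U))" "monomial y = monomial (d, \<sigma>)"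
      using E x by (auto simp: stab_monomial_n E_grp_eq)
    have "y = (d, \<sigma>)"
      using inj_onD[OF inj_on_monomial[OF False] y(2)] sub y(1) wreath_level_carrier[OF x(1)] by blast
    then show ?thesis
      using that x y(1) by blast
  qed
qed

text \<open>The unfolding replaces the product and unit of \<open>U\<close> by those of
  \<open>A\<close>, as they appear in the theorem.\<close>

lemma derived_wreath_units_iff:
  "(d, \<sigma>) \<in> wreath_level U n \<Longrightarrow> (d, \<sigma>) \<in> derived (wreath U) (carrier (wreath U)) \<longleftrightarrow>
    evenperm \<sigma> \<and> list_prod A d n \<in> derived U (carrier U)"
  by (rule group.derived_wreath_iff[OF units_group, unfolded units_of_mult units_of_one])

lemma E_grp_iff:
  "M \<in> carrier (GLn A z n) \<and> stab R n M \<in> E_grp A z \<longleftrightarrow>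
    (\<exists>\<sigma> a. \<sigma> permutes {..<n} \<and> evenperm \<sigma> \<and> (\<forall>i<n. a i \<in> Units A) \<and>
      M = diag_mat A z n a \<otimes>\<^bsub>Mn A z n\<^esub> perm_mat R n \<sigma> \<and>
      list_prod A a n \<in> derived U (carrier U))" (is "?L \<longleftrightarrow> ?R")
proof
  assume ?L
  then obtain d \<sigma> where x: "(d, \<sigma>) \<in> wreath_level U n" "M = monomial_n n (d, \<sigma>)"
    and E: "(d, \<sigma>) \<in> derived (wreath U) (carrier (wreath U))"
    using E_grp_imp_even_monomial by blast
  \<comment> \<open>Padding leaves \<open>d\<close> unchanged, so \<open>d\<close> itself serves as
    the witness for \<open>a\<close>.\<close>
  have "(\<lambda>i. if i < n then d i else \<one>) = d" and "\<sigma> permutes {..<n}" "\<forall>i<n. d i \<in> Units A"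
    using x(1) by (auto simp: wreath_level_units fun_eq_iff)
  then show ?R
    using E derived_wreath_units_iff[OF x(1)] x(2) diag_mat_mult_perm_mat(2)[of \<sigma> n d]
    by (intro exI[of _ \<sigma>] exI[of _ d]) simp
next
  assume ?R
  then obtain \<sigma> a where \<sigma>: "\<sigma> permutes {..<n}" "evenperm \<sigma>" and a: "\<forall>i<n. a i \<in> Units A"
    and M: "M = diag_mat A z n a \<otimes>\<^bsub>Mn A z n\<^esub> perm_mat R n \<sigma>"
    and prod: "list_prod A a n \<in> derived U (carrier U)"
    by blast
  define d where "d = (\<lambda>i. if i < n then a i else \<one>)"
  have lev: "(d, \<sigma>) \<in> wreath_level U n" and M': "M = monomial_n n (d, \<sigma>)"
    using diag_mat_mult_perm_mat[OF \<sigma>(1) a] M by (simp_all add: d_def)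
  have eq: "map d [0..<n] = map a [0..<n]"
    by (simp add: d_def)
  have "(d, \<sigma>) \<in> derived (wreath U) (carrier (wreath U))"
    unfolding derived_wreath_units_iff[OF lev] eq using \<sigma>(2) prod by simp
  then show ?L
    using lev by (auto simp: M' carrier_GLn stab_monomial_n E_grp_eq)
qed

end

theorem proposition2p4:
  fixes A :: "('a, 'm) monoid_scheme" and z :: 'a
  assumes "monoid_with_zero A z"
  shows "(\<forall>n\<ge>1. \<forall>M \<in> carrier (mats (reduced_ring A z) n).
           (M \<in> carrier (GLn A z n) \<and> stab (reduced_ring A z) n M \<in> E_grp A z) \<longleftrightarrow>
           (\<exists>\<sigma> a. \<sigma> permutes {..<n} \<and> evenperm \<sigma> \<and> (\<forall>i<n. a i \<in> Units A) \<and>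
              M = diag_mat A z n a \<otimes>\<^bsub>Mn A z n\<^esub> perm_mat (reduced_ring A z) n \<sigma> \<and>
              foldr (mult A) (map a [0..<n]) \<one>\<^bsub>A\<^esub> \<in> derived (units_of A) (carrier (units_of A))))
       \<and> derived (GL A z) (E_grp A z) = E_grp A z"
proof (intro conjI allI impI ballI)
  interpret monoid_with_zero A z by fact
  show "derived (GL A z) (E_grp A z) = E_grp A z"
    by (rule perfect_E_grp)
  fix n M
  show "(M \<in> carrier (GLn A z n) \<and> stab (reduced_ring A z) n M \<in> E_grp A z) \<longleftrightarrow>
      (\<exists>\<sigma> a. \<sigma> permutes {..<n} \<and> evenperm \<sigma> \<and> (\<forall>i<n. a i \<in> Units A) \<and>
        M = diag_mat A z n a \<otimes>\<^bsub>Mn A z n\<^esub> perm_mat (reduced_ring A z) n \<sigma> \<and>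
        foldr (mult A) (map a [0..<n]) \<one>\<^bsub>A\<^esub> \<in> derived (units_of A) (carrier (units_of A)))"
    by (rule E_grp_iff)
qed

end
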